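(* Assume that $n\ge0$ is an even integer. Then for every integer $k\ge0$, $$\mathbb{P}\{T_n=k,\,S_n=0\}=\begin{cases}\displaystyle\frac{2}{n+2}\binom{n}{n/2}(pq)^{n/2}&\text{if } k \text{ is even with } 0\le k\le n,\\[1.5ex] 0&\text{if } k\text{ is odd or } k\ge n+1.\end{cases}$$ The distribution of $T_n$ for the bridge of the random walk is given by $$\mathbb{P}\{T_n=k\mid S_n=0\}=\begin{cases}\displaystyle\frac{2}{n+2}&\text{if } k \text{ is even with } 0\le k\le n,\\[1.5ex] 0&\text{if } k\text{ is odd or } k\ge n+1,\end{cases}$$ that is, conditionally on $S_n=0$, $T_n$ is uniformly distributed on the set $\{0,2,4,\dots,n-2,n\}$.
   Context: Let $p\in(0,1)$, $q=1-p$, and let $(X_k)_{k\ge1}$ be independent random variables with $\mathbb{P}\{X_k=1\}=p$, $\mathbb{P}\{X_k=-1\}=q$. Let $S_0=0$ and $S_k=\sum_{j=1}^kX_j$ for $k\ge1$ (Bernoulli random walk on $\mathbb{Z}$). The modified sojourn time is $T_0=0$ and $T_n=\sum_{j=1}^n\delta_j$ for $n\ge1$, where $\delta_j=1$ if ($S_j>0$) or ($S_j=0$ and $S_{j-1}>0$), and $\delta_j=0$ if ($S_j<0$) or ($S_j=0$ and $S_{j-1}<0$). *)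

theory Defs
  imports "HOL-Probability.Probability"
begin

definition walk :: "(nat \<Rightarrow> 'a \<Rightarrow> int) \<Rightarrow> nat \<Rightarrow> 'a \<Rightarrow> int" where
  "walk X k \<omega> = (\<Sum>j=1..k. X j \<omega>)"

text \<open>
  For steps in \<open>{-1, 1}\<close> the \<open>else\<close> branch is exactly the case
  \<open>S\<^sub>j < 0\<close>, or \<open>S\<^sub>j = 0\<close> and \<open>S\<^sub>j\<^sub>-\<^sub>1 < 0\<close>.
  The remaining case \<open>S\<^sub>j = S\<^sub>j\<^sub>-\<^sub>1 = 0\<close> needs a zero step and has probability zero for the
  Bernoulli walk. The indicator is only used for \<open>j \<ge> 1\<close>, where \<open>j - 1\<close> does not truncate.
\<close>

definition sojourn_step :: "(nat \<Rightarrow> 'a \<Rightarrow> int) \<Rightarrow> nat \<Rightarrow> 'a \<Rightarrow> nat" where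
  "sojourn_step X j \<omega> =
     (if walk X j \<omega> > 0 \<or> (walk X j \<omega> = 0 \<and> walk X (j - 1) \<omega> > 0) then 1 else 0)"

definition sojourn_time :: "(nat \<Rightarrow> 'a \<Rightarrow> int) \<Rightarrow> nat \<Rightarrow> 'a \<Rightarrow> nat" where
  "sojourn_time X n \<omega> = (\<Sum>j=1..n. sojourn_step X j \<omega>)"

end

theory Submission
  imports Defs
begin

text \<open>
  Every path with \<open>S\<^sub>n = 0\<close> has probability \<open>(pq)\<^bsup>n/2\<^esup>\<close>, so the claim is the Chung-Feller
  theorem: the number of bridges of length \<open>2m\<close> with sojourn time \<open>2r\<close> does not depend on
  \<open>r \<le> m\<close>. Cutting a bridge at its first return to \<open>0\<close> after time \<open>0\<close> gives a recursion in which the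
  excursion is a Dyck word \<open>w\<close> of length \<open>2j\<close> wrapped in two steps, contributing \<open>2j + 2\<close> or \<open>0\<close>
  to the sojourn time according to its sign; strong induction on \<open>m\<close> then gives independence of
  \<open>r\<close>, and dividing the number of all bridges by \<open>m + 1\<close> gives the common value.
\<close>

section \<open>Bridges as words\<close>

fun nonneg_from :: "int \<Rightarrow> int list \<Rightarrow> bool" where
  "nonneg_from h [] \<longleftrightarrow> True"
| "nonneg_from h (x # xs) \<longleftrightarrow> h + x \<ge> 0 \<and> nonneg_from (h + x) xs"

text \<open>The argument \<open>h\<close> is the height before the next step and plays the role of
  the previous walk value in \<open>sojourn_step\<close>.\<close>

fun sojourn_from :: "int \<Rightarrow> int list \<Rightarrow> nat" where
  "sojourn_from h [] = 0"
| "sojourn_from h (x # xs) =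
     (if h + x > 0 \<or> (h + x = 0 \<and> h > 0) then 1 else 0) + sojourn_from (h + x) xs"

lemma sojourn_from_append:
  "sojourn_from h (xs @ ys) = sojourn_from h xs + sojourn_from (h + sum_list xs) ys"
  by (induction xs arbitrary: h) (auto simp: add.assoc)

lemma sojourn_from_le_length: "sojourn_from h xs \<le> length xs"
  by (induction xs arbitrary: h) (auto intro: le_SucI)

text \<open>A unit step from a height \<open>h >= 0\<close> fails to be counted only when it goes
  from 0 to -1. One such step makes the count strictly smaller than the length, whatever
  follows.\<close>

lemma sojourn_from_eq_length_iff:
  assumes "set xs \<subseteq> {-1, 1}" "h \<ge> 0"
  shows "sojourn_from h xs = length xs \<longleftrightarrow> nonneg_from h xs"
  using assms
proof (induction xs arbitrary: h)
  case (Cons x xs)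
  have "sojourn_from (h + x) xs \<le> length xs"
    by (rule sojourn_from_le_length)
  then show ?case
    using Cons.prems Cons.IH[of "h + x"] by auto
qed simp

text \<open>Raised by \<open>g - h > 0\<close>, the path stays strictly positive, so each step is
  counted. This is used for the Dyck word inside a positive excursion, which starts at height
  1.\<close>

lemma sojourn_from_above:
  assumes "nonneg_from h xs" "g > h" "h \<ge> 0"
  shows "sojourn_from g xs = length xs"
  using assms
proof (induction xs arbitrary: h g)
  case (Cons x xs)
  then show ?case
    using Cons.IH[of "h + x" "g + x"] by auto
qed simp

lemma sojourn_from_below:
  assumes "nonneg_from h xs" "g < - h" "h \<ge> 0"
  shows "sojourn_from g (map uminus xs) = 0"
  using assms
proof (induction xs arbitrary: h g)
  case (Cons x xs)
  then show ?case
    using Cons.IH[of "h + x" "g - x"] by auto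
qed simp

section \<open>First-passage decomposition of words\<close>

text \<open>Cut at the first step that goes below 0: steps being units, it goes from 0 to
  -1.\<close>

lemma first_passage_split:
  assumes "set xs \<subseteq> {-1, 1}" "h \<ge> 0" "h + sum_list xs < 0"
  shows "\<exists>w v. xs = w @ (-1) # v \<and> nonneg_from h w \<and> h + sum_list w = 0"
  using assms
proof (induction xs arbitrary: h)
  case (Cons x xs)
  show ?case
  proof (cases "h + x \<ge> 0")
    case True
    then obtain w v where "xs = w @ (-1) # v" "nonneg_from (h + x) w" "h + x + sum_list w = 0"
      using Cons.IH[of "h + x"] Cons.prems by (auto simp: add.assoc)
    then have "x # xs = (x # w) @ (-1) # v \<and> nonneg_from h (x # w) \<and> h + sum_list (x # w) = 0"
      using True by auto
    then show ?thesis by blast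
  next
    case False
    then have "x = -1" "h = 0" using Cons.prems by auto
    then have "x # xs = [] @ (-1) # xs \<and> nonneg_from h [] \<and> h + sum_list [] = 0" by simp
    then show ?thesis by blast
  qed
qed simp

text \<open>A longer candidate prefix would contain the step from 0 to -1 and violate nonnegativity,
  so the cut is determined. This makes the gluing maps below injective.\<close>

lemma first_passage_split_unique:
  assumes "w @ (-1) # v = w' @ (-1) # v'"
    and "nonneg_from h w" "h + sum_list w = 0"
    and "nonneg_from h w'" "h + sum_list w' = 0"
  shows "w = w' \<and> v = v'"
  using assms
proof (induction w arbitrary: h w')
  case Nil
  then show ?case by (cases w') auto
next
  case (Cons x w)
  then obtain y u where w': "w' = y # u" by (cases w') auto
  show ?case
    using Cons.prems Cons.IH[of u "h + x"] by (auto simp: w' add.assoc)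
qed

section \<open>Bridges and Dyck words\<close>

definition bridges :: "nat \<Rightarrow> int list set" where
  "bridges m = {xs. length xs = 2 * m \<and> set xs \<subseteq> {-1, 1} \<and> sum_list xs = 0}"

definition dyck :: "nat \<Rightarrow> int list set" where
  "dyck m = {xs \<in> bridges m. nonneg_from 0 xs}"

definition sojourn_bridges :: "nat \<Rightarrow> nat \<Rightarrow> int list set" where
  "sojourn_bridges m k = {xs \<in> bridges m. sojourn_from 0 xs = k}"

lemma finite_bridges: "finite (bridges m)"
  by (rule finite_subset[OF _ finite_lists_length_eq[of "{-1, 1}" "2 * m"]])
     (auto simp: bridges_def)

lemma finite_dyck: "finite (dyck m)"
  and finite_sojourn_bridges: "finite (sojourn_bridges m k)"
  by (auto simp: dyck_def sojourn_bridges_def finite_bridges)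

text \<open>A full count means that the path never goes below 0, so the Dyck words form the extreme
  class, which later identifies the common cardinality.\<close>

lemma dyck_eq_sojourn_bridges: "dyck m = sojourn_bridges m (2 * m)"
  using sojourn_from_eq_length_iff[of _ 0]
  by (fastforce simp: dyck_def sojourn_bridges_def bridges_def)

lemma even_length_balanced:
  assumes "set xs \<subseteq> {-1, 1 :: int}" "sum_list xs = 0"
  shows "even (length xs)"
proof -
  have "even (sum_list xs) \<longleftrightarrow> even (length xs)"
    using assms(1) by (induction xs) auto
  then show ?thesis using assms(2) by simp
qed

text \<open>The prefix before the cut sums to 0, so its length is even; the odd total then leaves an
  even length for the suffix.\<close>

lemma first_passage_bridge:
  assumes "length xs = 2 * m + 1" "set xs \<subseteq> {-1, 1}" "sum_list xs = -1"
  shows "\<exists>j\<le>m. \<exists>w\<in>dyck j. \<exists>v\<in>bridges (m - j). xs = w @ (-1) # v"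
proof -
  obtain w v where wv: "xs = w @ (-1) # v" "nonneg_from 0 w" "sum_list w = 0"
    using first_passage_split[of xs 0] assms by auto
  have w: "set w \<subseteq> {-1, 1}" and v: "set v \<subseteq> {-1, 1}" "sum_list v = 0"
    using assms wv by auto
  obtain j where j: "length w = 2 * j"
    using even_length_balanced[OF w wv(3)] by auto
  have "length v = 2 * (m - j)" "j \<le> m"
    using assms(1) wv(1) j by auto
  then show ?thesis
    using wv w v j by (auto simp: dyck_def bridges_def)
qed

section \<open>First-return decomposition of bridges\<close>

text \<open>The half-length \<open>j\<close> is kept in the triple so that the domain is a dependent
  sum over \<open>j\<close>, whose cardinality is a convolution.\<close>

definition join_up :: "nat \<times> int list \<times> int list \<Rightarrow> int list" where
  "join_up = (\<lambda>(j, w, v). 1 # w @ (-1) # v)"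

text \<open>Only the excursion is reflected; the remainder \<open>v\<close> is left as it is, so
  that its sojourn time is unchanged.\<close>

definition join_down :: "nat \<times> int list \<times> int list \<Rightarrow> int list" where
  "join_down = (\<lambda>(j, w, v). (-1) # map uminus w @ 1 # v)"

text \<open>The first-passage cut after the leading 1 is unique, which recovers \<open>w\<close> and
  \<open>v\<close>; the length of \<open>w\<close> recovers \<open>j\<close>.\<close>

lemma inj_on_join_up: "inj_on join_up (SIGMA j:J. dyck j \<times> B j)"
proof (rule inj_onI)
  fix a b
  assume a: "a \<in> (SIGMA j:J. dyck j \<times> B j)" and b: "b \<in> (SIGMA j:J. dyck j \<times> B j)"
    and eq: "join_up a = join_up b"
  obtain j w v where a': "a = (j, w, v)" by (cases a)
  obtain i u y where b': "b = (i, u, y)" by (cases b)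
  have "w = u \<and> v = y"
    by (rule first_passage_split_unique[where h = 0])
       (use a b eq in \<open>auto simp: a' b' join_up_def dyck_def bridges_def\<close>)
  then show "a = b"
    using a b by (auto simp: a' b' dyck_def bridges_def)
qed

text \<open>Reflecting the glued word turns its closing step into -1, so uniqueness of the
  first-passage cut applies again.\<close>

lemma inj_on_join_down: "inj_on join_down (SIGMA j:J. dyck j \<times> B j)"
proof (rule inj_onI)
  fix a b
  assume a: "a \<in> (SIGMA j:J. dyck j \<times> B j)" and b: "b \<in> (SIGMA j:J. dyck j \<times> B j)"
    and eq: "join_down a = join_down b"
  obtain j w v where a': "a = (j, w, v)" by (cases a)
  obtain i u y where b': "b = (i, u, y)" by (cases b)
  have "map uminus (map uminus w @ 1 # v) = map uminus (map uminus u @ 1 # y)"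
    using eq by (simp add: a' b' join_down_def)
  then have "w @ (-1) # map uminus v = u @ (-1) # map uminus y"
    by (simp add: comp_def)
  then have "w = u \<and> map uminus v = map uminus y"
    by (rule first_passage_split_unique[where h = 0])
       (use a b in \<open>auto simp: a' b' dyck_def bridges_def\<close>)
  then show "a = b"
    using a b by (auto simp: a' b' dyck_def bridges_def inj_map_eq_map)
qed

lemma sum_list_map_uminus: "sum_list (map uminus xs) = - sum_list (xs :: int list)"
  by (induction xs) auto

text \<open>Between its outer steps the excursion stays at height at least 1, and the closing step
  reaches 0 from 1, so all \<open>2 * j + 2\<close> steps count.\<close>

lemma join_up_bridge:
  assumes "w \<in> dyck j" "v \<in> bridges (m - j)" "j \<le> m"
  shows "join_up (j, w, v) \<in> bridges (Suc m)"
    and "sojourn_from 0 (join_up (j, w, v)) = 2 * j + 2 + sojourn_from 0 v"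
  using assms sojourn_from_above[of 0 w 1]
  by (auto simp: join_up_def dyck_def bridges_def sojourn_from_append)

text \<open>The closing step reaches 0 from -1 and is thus not counted, like all other steps of the
  excursion.\<close>

lemma join_down_bridge:
  assumes "w \<in> dyck j" "v \<in> bridges (m - j)" "j \<le> m"
  shows "join_down (j, w, v) \<in> bridges (Suc m)"
    and "sojourn_from 0 (join_down (j, w, v)) = sojourn_from 0 v"
  using assms sojourn_from_below[of 0 w "-1"]
  by (auto simp: join_down_def dyck_def bridges_def sojourn_from_append sum_list_map_uminus)

text \<open>After the first letter the word sums to -1 or to 1; the second case is reflected into
  the first.\<close>

lemma bridge_first_return:
  assumes "xs \<in> bridges (Suc m)"
  obtains j w v where "j \<le> m" "w \<in> dyck j" "v \<in> bridges (m - j)"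
    "xs = join_up (j, w, v) \<or> xs = join_down (j, w, v)"
proof -
  obtain x ys where xs: "xs = x # ys"
    using assms by (cases xs) (auto simp: bridges_def)
  consider "x = 1" | "x = -1" using assms by (auto simp: xs bridges_def)
  then show ?thesis
  proof cases
    case 1
    then obtain j w v where "j \<le> m" "w \<in> dyck j" "v \<in> bridges (m - j)" "ys = w @ (-1) # v"
      using first_passage_bridge[of ys m] assms by (auto simp: xs bridges_def)
    then show ?thesis using that[of j w v] 1 by (simp add: xs join_up_def)
  next
    case 2
    then have "length (map uminus ys) = 2 * m + 1" "set (map uminus ys) \<subseteq> {-1, 1}"
      "sum_list (map uminus ys) = -1"
      using assms unfolding xs bridges_def sum_list_map_uminus by auto
    then obtain j w v where *: "j \<le> m" "w \<in> dyck j" "v \<in> bridges (m - j)"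
      and eq: "map uminus ys = w @ (-1) # v"
      using first_passage_bridge by blast
    have "map uminus (map uminus ys) = map uminus w @ 1 # map uminus v"
      by (simp only: eq) simp
    then have "ys = map uminus w @ 1 # map uminus v" by (simp add: comp_def)
    \<comment> \<open>Reflecting back also flips the remainder, which is still a bridge.\<close>
    moreover have "map uminus v \<in> bridges (m - j)"
      using *(3) by (auto simp: bridges_def sum_list_map_uminus)
    ultimately show ?thesis using that[of j w "map uminus v"] * 2 by (simp add: xs join_down_def)
  qed
qed

section \<open>Recursion for the sojourn counts\<close>

text \<open>A positive excursion uses up \<open>2 * j + 2\<close> of the sojourn time; the guard
  keeps truncated subtraction from admitting an excursion longer than \<open>k\<close>.\<close>

lemma sojourn_bridges_Suc:
  "sojourn_bridges (Suc m) k =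
     join_up ` (SIGMA j:{..m}. dyck j \<times>
       (if 2 * j + 2 \<le> k then sojourn_bridges (m - j) (k - (2 * j + 2)) else {})) \<union>
     join_down ` (SIGMA j:{..m}. dyck j \<times> sojourn_bridges (m - j) k)"
    (is "_ = join_up ` ?U \<union> join_down ` ?D")
proof (intro equalityI subsetI)
  fix xs assume "xs \<in> sojourn_bridges (Suc m) k"
  then have xs: "xs \<in> bridges (Suc m)" "sojourn_from 0 xs = k"
    by (auto simp: sojourn_bridges_def)
  obtain j w v where jwv: "j \<le> m" "w \<in> dyck j" "v \<in> bridges (m - j)"
    "xs = join_up (j, w, v) \<or> xs = join_down (j, w, v)"
    using bridge_first_return[OF xs(1)] .
  from jwv(4) show "xs \<in> join_up ` ?U \<union> join_down ` ?D"
  proof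
    assume eq: "xs = join_up (j, w, v)"
    have "(j, w, v) \<in> ?U"
      using jwv xs join_up_bridge(2)[OF jwv(2,3,1)] by (auto simp: eq sojourn_bridges_def)
    then show ?thesis by (simp add: eq)
  next
    assume eq: "xs = join_down (j, w, v)"
    have "(j, w, v) \<in> ?D"
      using jwv xs join_down_bridge(2)[OF jwv(2,3,1)] by (auto simp: eq sojourn_bridges_def)
    then show ?thesis by (simp add: eq)
  qed
next
  fix xs assume "xs \<in> join_up ` ?U \<union> join_down ` ?D"
  then show "xs \<in> sojourn_bridges (Suc m) k"
    by (auto simp: sojourn_bridges_def join_up_bridge join_down_bridge split: if_splits)
qed

text \<open>The two images are disjoint because their words start with different letters, and
  injectivity of the gluing maps turns each into a convolution.\<close>

lemma card_sojourn_bridges_Suc: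
  "card (sojourn_bridges (Suc m) k) =
     (\<Sum>j\<le>m. card (dyck j) *
        ((if 2 * j + 2 \<le> k then card (sojourn_bridges (m - j) (k - (2 * j + 2))) else 0) +
         card (sojourn_bridges (m - j) k)))"
proof -
  let ?B = "\<lambda>j. if 2 * j + 2 \<le> k then sojourn_bridges (m - j) (k - (2 * j + 2)) else {}"
  let ?U = "SIGMA j:{..m}. dyck j \<times> ?B j"
  let ?D = "SIGMA j:{..m}. dyck j \<times> sojourn_bridges (m - j) k"
  have fin: "finite ?U" "finite ?D"
    by (auto intro!: finite_SigmaI simp: finite_dyck finite_sojourn_bridges)
  have "card (sojourn_bridges (Suc m) k) = card (join_up ` ?U) + card (join_down ` ?D)"
    unfolding sojourn_bridges_Suc
    by (rule card_Un_disjoint) (use fin in \<open>auto simp: join_up_def join_down_def\<close>)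
  also have "\<dots> = card ?U + card ?D"
    by (simp only: card_image inj_on_join_up inj_on_join_down)
  also have "\<dots> = (\<Sum>j\<le>m. card (dyck j) * card (?B j)) +
      (\<Sum>j\<le>m. card (dyck j) * card (sojourn_bridges (m - j) k))"
    by (subst (1 2) card_SigmaI)
       (auto simp: card_cartesian_product finite_dyck finite_sojourn_bridges simp del: card_SigmaI)
  finally show ?thesis
    by (simp add: sum.distrib algebra_simps if_distrib[of card] if_distrib[of "(*) _"] cong: if_cong)
qed

text \<open>
  The reflection \<open>j \<mapsto> m - j\<close> turns the contribution of the negative excursions into
  exactly the convolution terms that the positive ones leave out, so the sum does not depend on
  the sojourn time.
\<close>

theorem chung_feller:
  "card (sojourn_bridges m k) = (if even k \<and> k \<le> 2 * m then card (dyck m) else 0)"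
proof (induction m arbitrary: k rule: less_induct)
  case (less m)
  show ?case
  proof (cases m)
    case 0
    have "sojourn_bridges 0 k = (if k = 0 then {[]} else {})" for k
      by (auto simp: sojourn_bridges_def bridges_def)
    then show ?thesis by (simp add: 0 dyck_eq_sojourn_bridges)
  next
    case (Suc n)
    let ?d = "\<lambda>j. card (dyck j)"
    have IH: "card (sojourn_bridges (n - j) k) = (if even k \<and> k \<le> 2 * (n - j) then ?d (n - j) else 0)"
      for j k
      using less[of "n - j"] Suc by simp
    have even_case: "card (sojourn_bridges m (2 * r)) = (\<Sum>j\<le>n. ?d j * ?d (n - j))" if r: "r \<le> Suc n" for r
    proof -
      \<comment> \<open>For \<open>k = 2 * r\<close> the guard reads \<open>j < r\<close>, and then
        \<open>r <= Suc n\<close> already makes the remaining time at most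
        \<open>2 * (n - j)\<close>.\<close>
      have "card (sojourn_bridges m (2 * r)) =
          (\<Sum>j\<le>n. (if j < r then ?d j * ?d (n - j) else 0) + (if r \<le> n - j then ?d j * ?d (n - j) else 0))"
        unfolding Suc card_sojourn_bridges_Suc IH using r
        by (intro sum.cong) (auto simp: algebra_simps)
      also have "\<dots> = (\<Sum>j\<le>n. if j < r then ?d j * ?d (n - j) else 0) +
          (\<Sum>j\<le>n. if r \<le> n - j then ?d j * ?d (n - j) else 0)"
        by (rule sum.distrib)
      also have "(\<Sum>j\<le>n. if r \<le> n - j then ?d j * ?d (n - j) else 0) =
          (\<Sum>j\<le>n. if r \<le> j then ?d j * ?d (n - j) else 0)"
        by (rule sum.reindex_bij_witness[of _ "\<lambda>j. n - j" "\<lambda>j. n - j"]) (auto simp: mult.commute)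
      finally show ?thesis
        by (simp add: sum.distrib[symmetric]) (auto intro!: sum.cong)
    qed
    show ?thesis
    proof (cases "even k \<and> k \<le> 2 * m")
      case True
      then obtain r where "k = 2 * r" by auto
      \<comment> \<open>The instance \<open>r = Suc n\<close> is the Dyck class, so the common value
        is \<open>card (dyck m)\<close>.\<close>
      then show ?thesis
        using True even_case[of r] even_case[of "Suc n"] Suc
        by (simp add: dyck_eq_sojourn_bridges)
    next
      case False
      \<comment> \<open>Subtracting \<open>2 * j + 2\<close> keeps an odd time odd and an excessive
        time above the new maximum \<open>2 * (n - j)\<close>, so every term is 0 by
        induction.\<close>
      then show ?thesis
        unfolding Suc card_sojourn_bridges_Suc IH by (auto intro!: sum.neutral)
    qed
  qed
qed

section \<open>Numbers of bridges and of Dyck words\<close>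

text \<open>Pascal's rule, splitting by the first letter.\<close>

lemma card_signed_words:
  "card {xs. length xs = n \<and> set xs \<subseteq> {-1, 1 :: int} \<and> count_list xs 1 = k} = n choose k"
proof (induction n arbitrary: k)
  case 0
  have "{xs. length xs = 0 \<and> set xs \<subseteq> {-1, 1 :: int} \<and> count_list xs 1 = k} = (if k = 0 then {[]} else {})"
    by auto
  then show ?case by (simp split: if_splits)
next
  case (Suc n)
  let ?W = "\<lambda>n k. {xs. length xs = n \<and> set xs \<subseteq> {-1, 1 :: int} \<and> count_list xs 1 = k}"
  have fin: "finite (?W n k)" for n k
    by (rule finite_subset[OF _ finite_lists_length_eq[of "{-1, 1}" n]]) auto
  have minus: "card ((#) (-1) ` ?W n k) = n choose k" and plus: "card ((#) 1 ` ?W n k) = n choose k" for k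
    using Suc.IH[of k] by (simp_all add: card_image)
  show ?case
  proof (cases k)
    case 0
    have "?W (Suc n) k = (#) (-1) ` ?W n k"
      by (auto simp: 0 length_Suc_conv image_iff split: if_splits)
    then show ?thesis using minus[of k] by (simp add: 0)
  next
    case (Suc l)
    have "?W (Suc n) k = (#) 1 ` ?W n l \<union> (#) (-1) ` ?W n k"
      by (auto simp: Suc length_Suc_conv image_iff split: if_splits)
    also have "card \<dots> = card ((#) 1 ` ?W n l) + card ((#) (-1) ` ?W n k)"
      by (rule card_Un_disjoint) (use fin in auto)
    finally show ?thesis using minus[of k] plus[of l] by (simp add: Suc)
  qed
qed

lemma sum_list_signed_word:
  assumes "set xs \<subseteq> {-1, 1 :: int}"
  shows "sum_list xs = 2 * int (count_list xs 1) - int (length xs)"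
  using assms by (induction xs) auto

lemma bridges_eq_signed_words:
  "bridges m = {xs. length xs = 2 * m \<and> set xs \<subseteq> {-1, 1} \<and> count_list xs 1 = m}"
  using sum_list_signed_word by (fastforce simp: bridges_def)

lemma card_bridges: "card (bridges m) = (2 * m) choose m"
  unfolding bridges_eq_signed_words by (rule card_signed_words)

text \<open>The bridges split into \<open>m + 1\<close> classes, one for each even sojourn time up
  to \<open>2 * m\<close>, all of the same size; this yields the Catalan number.\<close>

lemma card_dyck: "real (card (dyck m)) = real ((2 * m) choose m) / (real m + 1)"
proof -
  have "bridges m = (\<Union>k\<le>m. sojourn_bridges m (2 * k))"
  proof (intro equalityI subsetI)
    fix xs assume xs: "xs \<in> bridges m"
    let ?k = "sojourn_from 0 xs"
    have "xs \<in> sojourn_bridges m ?k" using xs by (simp add: sojourn_bridges_def)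
    \<comment> \<open>A sojourn time that occurs has a nonempty class, so
      \<open>chung_feller\<close> forces it to be even and at most \<open>2 * m\<close>.\<close>
    then have "card (sojourn_bridges m ?k) \<noteq> 0"
      using finite_sojourn_bridges[of m ?k] by auto
    then have "even ?k" "?k \<le> 2 * m" using chung_feller[of m ?k] by (auto split: if_splits)
    then show "xs \<in> (\<Union>k\<le>m. sojourn_bridges m (2 * k))"
      using xs by (auto simp: sojourn_bridges_def elim!: evenE intro!: bexI[of _ "?k div 2"])
  qed (auto simp: sojourn_bridges_def)
  also have "card \<dots> = (\<Sum>k\<le>m. card (sojourn_bridges m (2 * k)))"
    by (rule card_UN_disjoint) (auto simp: finite_sojourn_bridges, auto simp: sojourn_bridges_def)
  also have "\<dots> = (m + 1) * card (dyck m)"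
    by (simp add: chung_feller)
  finally have "(2 * m) choose m = (m + 1) * card (dyck m)"
    by (simp add: card_bridges)
  then have "real ((2 * m) choose m) = (real m + 1) * real (card (dyck m))"
    by (simp only: of_nat_mult of_nat_add of_nat_1)
  then show ?thesis by (simp add: field_simps)
qed

section \<open>The random bridge\<close>

text \<open>List position \<open>i\<close> holds step \<open>i + 1\<close>, as there is no step at
  time 0.\<close>

definition steps :: "(nat \<Rightarrow> 'a \<Rightarrow> int) \<Rightarrow> nat \<Rightarrow> 'a \<Rightarrow> int list" where
  "steps X n \<omega> = map (\<lambda>j. X j \<omega>) [1..<Suc n]"

lemma walk_eq_steps: "walk X n \<omega> = sum_list (steps X n \<omega>)"
  by (induction n) (auto simp: walk_def steps_def)

text \<open>When a step is appended, the height before it is \<open>walk X n\<close>, exactly the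
  previous value that \<open>sojourn_step\<close> inspects.\<close>

lemma sojourn_time_eq_steps: "sojourn_time X n \<omega> = sojourn_from 0 (steps X n \<omega>)"
proof (induction n)
  case 0
  then show ?case by (simp add: sojourn_time_def steps_def)
next
  case (Suc n)
  have "steps X (Suc n) \<omega> = steps X n \<omega> @ [X (Suc n) \<omega>]"
    by (simp add: steps_def)
  moreover have "walk X (Suc n) \<omega> = walk X n \<omega> + X (Suc n) \<omega>"
    by (simp add: walk_def)
  ultimately show ?case
    using Suc by (simp add: sojourn_time_def sojourn_step_def sojourn_from_append walk_eq_steps)
qed

lemma steps_eq_iff:
  assumes "length xs = n"
  shows "steps X n \<omega> = xs \<longleftrightarrow> (\<forall>j\<in>{1..n}. X j \<omega> = xs ! (j - 1))"
proof -
  have "steps X n \<omega> = xs \<longleftrightarrow> (\<forall>i<n. X (Suc i) \<omega> = xs ! i)"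
    using assms by (auto simp: steps_def list_eq_iff_nth_eq simp del: upt_Suc)
  also have "\<dots> \<longleftrightarrow> (\<forall>j\<in>{1..n}. X j \<omega> = xs ! (j - 1))"
  proof safe
    fix j assume "\<forall>i<n. X (Suc i) \<omega> = xs ! i" "j \<in> {1..n}"
    then show "X j \<omega> = xs ! (j - 1)" by (cases j) auto
  next
    fix i assume "\<forall>j\<in>{1..n}. X j \<omega> = xs ! (j - 1)" "i < n"
    then show "X (Suc i) \<omega> = xs ! i" by (auto dest!: bspec[of _ _ "Suc i"])
  qed
  finally show ?thesis .
qed

section \<open>Measurability and path probabilities\<close>

text \<open>Integer lists are countable, so singletons suffice; a list of the wrong length has empty
  preimage.\<close>

lemma measurable_steps:
  assumes "\<And>j. j \<ge> 1 \<Longrightarrow> X j \<in> measurable M (count_space UNIV)"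
  shows "steps X n \<in> measurable M (count_space UNIV)"
proof -
  have "steps X n -` {xs} \<inter> space M \<in> sets M" for xs
  proof (cases "length xs = n")
    case True
    have "steps X n -` {xs} \<inter> space M = {\<omega> \<in> space M. \<forall>j\<in>{1..n}. X j \<omega> = xs ! (j - 1)}"
      unfolding steps_eq_iff[OF True, symmetric] by auto
    also have "\<dots> \<in> sets M"
    proof (rule sets.sets_Collect_finite_All)
      fix j assume "j \<in> {1..n}"
      then have "X j -` {xs ! (j - 1)} \<inter> space M \<in> sets M"
        by (intro measurable_sets[OF assms]) auto
      then show "{\<omega> \<in> space M. X j \<omega> = xs ! (j - 1)} \<in> sets M"
        by (simp add: vimage_def Int_def conj_commute)
    qed auto
    finally show ?thesis .
  next
    case False
    then have "steps X n -` {xs} \<inter> space M = {}" by (auto simp: steps_def simp del: upt_Suc)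
    then show ?thesis by simp
  qed
  then show ?thesis by (subst measurable_count_space_eq_countable) auto
qed

lemma (in prob_space) prob_steps_eq:
  assumes "indep_vars (\<lambda>_. count_space UNIV) X {1..}" "length xs = n"
  shows "\<P>(\<omega> in M. steps X n \<omega> = xs) = (\<Prod>j\<in>{1..n}. \<P>(\<omega> in M. X j \<omega> = xs ! (j - 1)))"
\<comment> \<open>The case \<open>n = 0\<close> is separate since an empty intersection would be the
  whole type rather than \<open>space M\<close>.\<close>
proof (cases "n = 0")
  case True
  then show ?thesis using assms(2) by (simp add: steps_def prob_space)
next
  case False
  have "{\<omega> \<in> space M. steps X n \<omega> = xs} = (\<Inter>j\<in>{1..n}. X j -` {xs ! (j - 1)} \<inter> space M)"
    unfolding steps_eq_iff[OF assms(2)] using False by auto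
  also have "prob \<dots> = (\<Prod>j\<in>{1..n}. prob (X j -` {xs ! (j - 1)} \<inter> space M))"
    by (rule indep_varsD[OF assms(1)]) (use False in auto)
  also have "\<dots> = (\<Prod>j\<in>{1..n}. \<P>(\<omega> in M. X j \<omega> = xs ! (j - 1)))"
    by (simp add: vimage_def Int_def conj_commute)
  finally show ?thesis .
qed

text \<open>Induction peels off the last letter, so that the positions of the other letters, and
  hence their factors, stay fixed.\<close>

lemma prod_signed_word:
  assumes "set xs \<subseteq> {-1, 1 :: int}"
  shows "(\<Prod>j\<in>{1..length xs}. if xs ! (j - 1) = 1 then p else q) =
    (p :: real) ^ count_list xs 1 * q ^ (length xs - count_list xs 1)"
  using assms
proof (induction xs rule: rev_induct)
  case (snoc x xs)
  have "(\<Prod>j\<in>{1..length xs}. if (xs @ [x]) ! (j - 1) = 1 then p else q) =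
      (\<Prod>j\<in>{1..length xs}. if xs ! (j - 1) = 1 then p else q)"
    by (intro prod.cong) (auto simp: nth_append)
  then show ?case
    using snoc count_le_length[of xs 1] by (auto simp: Suc_diff_le)
qed simp

text \<open>A bridge has \<open>m\<close> steps of each sign, so its weight does not depend on their
  order.\<close>

lemma (in prob_space) prob_steps_bridge:
  assumes "indep_vars (\<lambda>_. count_space UNIV) X {1..}"
    and p: "\<And>j. j \<ge> 1 \<Longrightarrow> \<P>(\<omega> in M. X j \<omega> = 1) = p"
    and q: "\<And>j. j \<ge> 1 \<Longrightarrow> \<P>(\<omega> in M. X j \<omega> = -1) = q"
    and xs: "xs \<in> bridges m"
  shows "\<P>(\<omega> in M. steps X (2 * m) \<omega> = xs) = (p * q) ^ m"
proof -
  have len: "length xs = 2 * m" and set: "set xs \<subseteq> {-1, 1}" and count: "count_list xs 1 = m"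
    using xs by (auto simp: bridges_eq_signed_words)
  have "\<P>(\<omega> in M. steps X (2 * m) \<omega> = xs) =
      (\<Prod>j\<in>{1..2 * m}. \<P>(\<omega> in M. X j \<omega> = xs ! (j - 1)))"
    using prob_steps_eq[OF assms(1) len] .
  also have "\<dots> = (\<Prod>j\<in>{1..length xs}. if xs ! (j - 1) = 1 then p else q)"
  proof (rule prod.cong)
    fix j assume "j \<in> {1..length xs}"
    then have "xs ! (j - 1) \<in> {-1, 1}" "j \<ge> 1"
      using subsetD[OF set nth_mem[of "j - 1" xs]] by auto
    then show "\<P>(\<omega> in M. X j \<omega> = xs ! (j - 1)) = (if xs ! (j - 1) = 1 then p else q)"
      using p[of j] q[of j] by auto
  qed (simp add: len)
  also have "\<dots> = (p * q) ^ m"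
    unfolding prod_signed_word[OF set] by (simp add: count len power_mult_distrib)
  finally show ?thesis .
qed

text \<open>The two point masses sum to 1, so no other step value carries mass.\<close>

lemma (in prob_space) AE_steps_signed:
  assumes "indep_vars (\<lambda>_. count_space UNIV) X {1..}"
    and p: "\<And>j. j \<ge> 1 \<Longrightarrow> \<P>(\<omega> in M. X j \<omega> = 1) = p"
    and q: "\<And>j. j \<ge> 1 \<Longrightarrow> \<P>(\<omega> in M. X j \<omega> = -1) = 1 - p"
  shows "AE \<omega> in M. set (steps X n \<omega>) \<subseteq> {-1, 1}"
proof -
  have "AE \<omega> in M. X j \<omega> \<in> {-1, 1}" if j: "j \<ge> 1" for j
  proof -
    have "X j \<in> measurable M (count_space UNIV)"
      using assms(1) j by (simp add: indep_vars_def)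
    then have ev: "{\<omega> \<in> space M. X j \<omega> = c} \<in> events" for c
      using measurable_sets[of "X j" M "count_space UNIV" "{c}"]
      by (simp add: vimage_def Int_def conj_commute)
    have "prob ({\<omega> \<in> space M. X j \<omega> = 1} \<union> {\<omega> \<in> space M. X j \<omega> = -1}) = 1"
      using p[OF j] q[OF j] by (subst finite_measure_Union) (auto simp: ev)
    then have "AE \<omega> in M. \<omega> \<in> {\<omega> \<in> space M. X j \<omega> = 1} \<union> {\<omega> \<in> space M. X j \<omega> = -1}"
      by (subst (asm) prob_eq_1) (auto simp: ev)
    then show ?thesis by eventually_elim auto
  qed
  then have "AE \<omega> in M. \<forall>j\<in>{1..n}. X j \<omega> \<in> {-1, 1}"
    by (intro AE_finite_allI) auto
  then show ?thesis
    by eventually_elim (auto simp: steps_def)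
qed

text \<open>All bridges have the same weight, so probability reduces to counting. The free predicate
  \<open>Q\<close> serves both the joint law and, taken to be true, the bridge event alone.\<close>

lemma (in prob_space) prob_bridge_event:
  assumes indep: "indep_vars (\<lambda>_. count_space UNIV) X {1..}"
    and p: "\<And>j. j \<ge> 1 \<Longrightarrow> \<P>(\<omega> in M. X j \<omega> = 1) = p"
    and q: "\<And>j. j \<ge> 1 \<Longrightarrow> \<P>(\<omega> in M. X j \<omega> = -1) = 1 - p"
  shows "\<P>(\<omega> in M. Q (steps X (2 * m) \<omega>) \<and> walk X (2 * m) \<omega> = 0) =
    real (card {xs \<in> bridges m. Q xs}) * (p * (1 - p)) ^ m"
proof -
  let ?L = "steps X (2 * m)"
  let ?B = "{xs \<in> bridges m. Q xs}"
  have L: "?L \<in> measurable M (count_space UNIV)"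
    using indep by (intro measurable_steps) (auto simp: indep_vars_def)
  have ev: "{\<omega> \<in> space M. R (?L \<omega>)} \<in> events" for R
    using measurable_sets[OF L, of "Collect R"] by (simp add: vimage_def Int_def conj_commute)
  \<comment> \<open>Step values other than 1 and -1 are excluded only almost surely, so the two
    events are compared up to a null set.\<close>
  have "\<P>(\<omega> in M. Q (?L \<omega>) \<and> walk X (2 * m) \<omega> = 0) = \<P>(\<omega> in M. ?L \<omega> \<in> ?B)"
  proof (rule finite_measure_eq_AE)
    show "AE \<omega> in M. \<omega> \<in> {\<omega> \<in> space M. Q (?L \<omega>) \<and> walk X (2 * m) \<omega> = 0} \<longleftrightarrow>
        \<omega> \<in> {\<omega> \<in> space M. ?L \<omega> \<in> ?B}"
    proof -
      have "AE \<omega> in M. set (?L \<omega>) \<subseteq> {-1, 1}"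
        by (rule AE_steps_signed[OF indep]) (use p q in auto)
      then show ?thesis
        by eventually_elim (auto simp: bridges_def walk_eq_steps, auto simp: steps_def)
    qed
  qed (use ev in \<open>auto simp: walk_eq_steps\<close>)
  also have "{\<omega> \<in> space M. ?L \<omega> \<in> ?B} = (\<Union>xs\<in>?B. {\<omega> \<in> space M. ?L \<omega> = xs})"
    by auto
  also have "prob \<dots> = (\<Sum>xs\<in>?B. \<P>(\<omega> in M. ?L \<omega> = xs))"
    by (rule finite_measure_finite_Union)
       (use ev in \<open>auto simp: finite_bridges disjoint_family_on_def\<close>)
  also have "\<dots> = (\<Sum>xs\<in>?B. (p * (1 - p)) ^ m)"
    using prob_steps_bridge[OF indep p q] by (intro sum.cong) auto
  finally show ?thesis by simp
qed

section \<open>Law of the sojourn time on the random bridge\<close>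

theorem theorem6p2:
  fixes M :: "'a measure" and X :: "nat \<Rightarrow> 'a \<Rightarrow> int" and p q :: real and n :: nat
  assumes "prob_space M"
    and "0 < p" and "p < 1" and "q = 1 - p"
    and "prob_space.indep_vars M (\<lambda>_. count_space UNIV) X {1..}"
    and "\<And>j. j \<ge> 1 \<Longrightarrow> \<P>(\<omega> in M. X j \<omega> = 1) = p"
    and "\<And>j. j \<ge> 1 \<Longrightarrow> \<P>(\<omega> in M. X j \<omega> = -1) = q"
    and "even n"
  shows "(\<forall>k::nat. \<P>(\<omega> in M. sojourn_time X n \<omega> = k \<and> walk X n \<omega> = 0) =
           (if even k \<and> k \<le> n
            then 2 / (real n + 2) * real (n choose (n div 2)) * (p * q) ^ (n div 2)
            else 0)) \<and>
         (\<forall>k::nat. \<P>(\<omega> in M. sojourn_time X n \<omega> = k \<bar> walk X n \<omega> = 0) =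
           (if even k \<and> k \<le> n then 2 / (real n + 2) else 0)) \<and>
         distr (uniform_measure M {\<omega> \<in> space M. walk X n \<omega> = 0}) (count_space UNIV) (sojourn_time X n) =
           measure_pmf (pmf_of_set {k. even k \<and> k \<le> n})"
proof -
  interpret prob_space M by fact
  obtain m where n: "n = 2 * m" using assms(8) by auto
  let ?T = "sojourn_time X n"
  let ?B = "{\<omega> \<in> space M. walk X n \<omega> = 0}"
  let ?A = "{k. even k \<and> k \<le> n}"
  note indep = assms(5)
  have q: "\<P>(\<omega> in M. X j \<omega> = -1) = 1 - p" if "j \<ge> 1" for j
    using assms(4,7) that by simp
  note event = prob_bridge_event[OF indep assms(6) q]
  \<comment> \<open>With \<open>n = 2 * m\<close> the Catalan factor \<open>1 / (m + 1)\<close>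
    becomes \<open>2 / (n + 2)\<close>.\<close>
  have joint: "\<P>(\<omega> in M. ?T \<omega> = k \<and> walk X n \<omega> = 0) =
      (if even k \<and> k \<le> n then 2 / (real n + 2) * real (n choose (n div 2)) * (p * q) ^ (n div 2) else 0)"
    for k
    using event[of "\<lambda>xs. sojourn_from 0 xs = k" m]
    by (simp add: n sojourn_time_eq_steps chung_feller card_dyck assms(4)
        flip: sojourn_bridges_def) (simp add: field_simps)
  have bridge: "prob ?B = real (n choose (n div 2)) * (p * q) ^ (n div 2)"
    using event[of "\<lambda>_. True" m] by (simp add: n card_bridges assms(4))
  \<comment> \<open>Strict positivity of \<open>p\<close> and \<open>q\<close> makes conditioning on
    the bridge a genuine division.\<close>
  have pos: "prob ?B > 0"
    unfolding bridge using assms(2-4) by (simp add: zero_less_binomial_iff)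
  have cond: "\<P>(\<omega> in M. ?T \<omega> = k \<bar> walk X n \<omega> = 0) =
      (if even k \<and> k \<le> n then 2 / (real n + 2) else 0)" for k
  proof -
    have "\<P>(\<omega> in M. ?T \<omega> = k \<and> walk X n \<omega> = 0) =
        (if even k \<and> k \<le> n then 2 / (real n + 2) else 0) * prob ?B"
      unfolding joint bridge by simp
    then show ?thesis using pos by (simp only: cond_prob_def) simp
  qed
  have L: "steps X n \<in> measurable M (count_space UNIV)"
    using indep by (intro measurable_steps) (auto simp: indep_vars_def)
  have T: "?T \<in> measurable M (count_space UNIV)"
    unfolding sojourn_time_eq_steps[abs_def] by (rule measurable_compose[OF L]) simp
  have B: "?B \<in> events"
    using measurable_sets[OF L, of "{xs. sum_list xs = 0}"]
    by (simp add: walk_eq_steps vimage_def Int_def conj_commute)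
  have A: "finite ?A" "?A \<noteq> {}" "card ?A = m + 1"
  proof -
    have "?A = (*) 2 ` {..m}" by (auto simp: n elim!: evenE)
    then show "card ?A = m + 1" by (simp add: card_image inj_on_def)
  qed (auto intro: exI[of _ 0])
  have "distr (uniform_measure M ?B) (count_space UNIV) ?T = measure_pmf (pmf_of_set ?A)"
  \<comment> \<open>Both measures live on the countable type of naturals, so comparing point masses
    suffices; those on the left are the conditional probabilities already found.\<close>
  proof (rule measure_eqI_countable[of _ UNIV])
    fix k :: nat
    have Tk: "?T -` {k} \<inter> space M \<in> events" using measurable_sets[OF T, of "{k}"] by simp
    have "emeasure (distr (uniform_measure M ?B) (count_space UNIV) ?T) {k} =
        emeasure (uniform_measure M ?B) (?T -` {k} \<inter> space M)"
      using T by (subst emeasure_distr) (auto simp: measurable_def)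
    also have "\<dots> = emeasure M (?B \<inter> (?T -` {k} \<inter> space M)) / emeasure M ?B"
      by (rule emeasure_uniform_measure[OF B Tk])
    also have "?B \<inter> (?T -` {k} \<inter> space M) = {\<omega> \<in> space M. ?T \<omega> = k \<and> walk X n \<omega> = 0}"
      by auto
    also have "emeasure M \<dots> / emeasure M ?B = ennreal (\<P>(\<omega> in M. ?T \<omega> = k \<bar> walk X n \<omega> = 0))"
      unfolding emeasure_eq_measure cond_prob_def
      by (rule divide_ennreal[OF measure_nonneg pos])
    also have "\<dots> = emeasure (measure_pmf (pmf_of_set ?A)) {k}"
    proof -
      have "2 / (real n + 2) = 1 / real (card ?A)"
        by (simp only: A(3)) (simp add: n divide_simps)
      then show ?thesis
        unfolding cond emeasure_pmf_single using A(1,2) by simp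
    qed
    finally show "emeasure (distr (uniform_measure M ?B) (count_space UNIV) ?T) {k} =
        emeasure (measure_pmf (pmf_of_set ?A)) {k}" .
  qed auto
  then show ?thesis using joint cond by blast
qed

end
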